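(* Let $\alpha\ge 1$ be an integer, $\epsilon \in (0,1)$, and let $G$ be a simple graph on $n$ vertices whose edges arrive as a stream $e_1,\ldots,e_m$ in arbitrary order (each edge once). Consider the following algorithm. Initialize $S \leftarrow \emptyset$, $p \leftarrow 1$, $\mathrm{max} \leftarrow 0$. For each edge $e=uv$ in the stream, in order: (a) with probability $p$ (independently), add $e$ to $S$ and initialize two counters $c^u_e \leftarrow 0$, $c^v_e \leftarrow 0$; (b) for each edge $e' \in S$ that shares an endpoint $w$ with $e$, increment $c^w_{e'}$, and if $c^w_{e'} > \alpha$, remove $e'$ and its counters from $S$; (c) if $|S| > 30\epsilon^{-2}\log n$, set $p \leftarrow p/2$ and remove each edge of $S$ (with its counters) independently with probability $1/2$; (d) set $\mathrm{max} \leftarrow \max(\mathrm{max}, |S|/p)$. At the end, output $\mathrm{max}$. Then with high probability (i.e., with probability at least $1-1/\mathrm{poly}(n)$), the output is a $(1+\epsilon)$-approximation of $E^*$, i.e., lies in $[(1-\epsilon)E^*, (1+\epsilon)E^*]$.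
   Context: For $1\le t\le m$, $E_\alpha^t$ is the set of edges $uv$ among $e_1,\ldots,e_t$ such that, among $e_1,\ldots,e_t$, at most $\alpha$ edges incident to $u$ appear after $uv$ and at most $\alpha$ edges incident to $v$ appear after $uv$; $E^* = \max_{t} |E_\alpha^t|$. *)

theory Defs
  imports "HOL-Probability.Probability"
begin

definition simple_graph :: "'a set \<Rightarrow> 'a set set \<Rightarrow> bool" where
  "simple_graph V E \<longleftrightarrow> finite V \<and> (\<forall>e\<in>E. e \<subseteq> V \<and> card e = 2)"

definition edge_stream :: "'a set set \<Rightarrow> 'a set list \<Rightarrow> bool" where
  "edge_stream E es \<longleftrightarrow> distinct es \<and> set es = E"

text \<open>The edge $e_t$ of the stream is \<open>es ! (t - 1)\<close>, so that $e_1,\ldots,e_t$ are the entries of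
  \<open>es\<close> at the positions below \<open>t\<close>.\<close>

definition E_alpha :: "nat \<Rightarrow> 'a set list \<Rightarrow> nat \<Rightarrow> 'a set set" where
  "E_alpha \<alpha> es t =
    {es ! i | i. i < t \<and> (\<forall>w \<in> es ! i. card {j. i < j \<and> j < t \<and> w \<in> es ! j} \<le> \<alpha>)}"

text \<open>Inserting 0 only matters for the empty stream, where it gives \<open>E_star \<alpha> [] = 0\<close>.\<close>

definition E_star :: "nat \<Rightarrow> 'a set list \<Rightarrow> nat" where
  "E_star \<alpha> es = Max (insert 0 ((\<lambda>t. card (E_alpha \<alpha> es t)) ` {1..length es}))"

text \<open>\<open>counter st e w\<close> is the counter $c^w_e$; it is meaningful only for \<open>e \<in> sample st\<close> and
  \<open>w \<in> e\<close>. Dropping an edge from \<open>sample\<close> thus discards its counters.\<close>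

record 'a state =
  sample :: "'a set set"
  counter :: "'a set \<Rightarrow> 'a \<Rightarrow> nat"
  rate :: real
  maxest :: real

definition init_state :: "'a state" where
  "init_state = \<lparr>sample = {}, counter = (\<lambda>_ _. 0), rate = 1, maxest = 0\<rparr>"

definition add_edge :: "'a set \<Rightarrow> 'a state \<Rightarrow> 'a state pmf" where
  "add_edge e st = do {
     b \<leftarrow> bernoulli_pmf (rate st);
     return_pmf (if b
       then st\<lparr>sample := insert e (sample st), counter := (counter st)(e := (\<lambda>_. 0))\<rparr>
       else st)
   }"

text \<open>The arriving edge \<open>e\<close> does not increment its own counters: they count the edges arriving
  after \<open>e\<close>.\<close>

definition update_counters :: "nat \<Rightarrow> 'a set \<Rightarrow> 'a state \<Rightarrow> 'a state" where
  "update_counters \<alpha> e st =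
    (let S = sample st;
         c = (\<lambda>e' w. if e' \<in> S \<and> e' \<noteq> e \<and> w \<in> e' \<inter> e
                     then counter st e' w + 1 else counter st e' w)
     in st\<lparr>sample := {e' \<in> S. \<not> (e' \<noteq> e \<and> (\<exists>w \<in> e' \<inter> e. c e' w > \<alpha>))}, counter := c\<rparr>)"

definition subsample :: "real \<Rightarrow> nat \<Rightarrow> 'a state \<Rightarrow> 'a state pmf" where
  "subsample \<epsilon> n st =
    (if real (card (sample st)) > 30 * (1 / \<epsilon>\<^sup>2) * ln (real n)
     then do {
       keep \<leftarrow> Pi_pmf (sample st) False (\<lambda>_. bernoulli_pmf (1 / 2));
       return_pmf (st\<lparr>sample := {e \<in> sample st. keep e}, rate := rate st / 2\<rparr>)
     }
     else return_pmf st)"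

definition update_max :: "'a state \<Rightarrow> 'a state" where
  "update_max st = st\<lparr>maxest := max (maxest st) (real (card (sample st)) / rate st)\<rparr>"

definition step :: "nat \<Rightarrow> real \<Rightarrow> nat \<Rightarrow> 'a set \<Rightarrow> 'a state \<Rightarrow> 'a state pmf" where
  "step \<alpha> \<epsilon> n e st = do {
     st1 \<leftarrow> add_edge e st;
     st2 \<leftarrow> subsample \<epsilon> n (update_counters \<alpha> e st1);
     return_pmf (update_max st2)
   }"

primrec run :: "nat \<Rightarrow> real \<Rightarrow> nat \<Rightarrow> 'a set list \<Rightarrow> 'a state \<Rightarrow> 'a state pmf" where
  "run \<alpha> \<epsilon> n [] st = return_pmf st"
| "run \<alpha> \<epsilon> n (e # es) st = do { st' \<leftarrow> step \<alpha> \<epsilon> n e st; run \<alpha> \<epsilon> n es st' }"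

definition algorithm_output :: "nat \<Rightarrow> real \<Rightarrow> nat \<Rightarrow> 'a set list \<Rightarrow> real pmf" where
  "algorithm_output \<alpha> \<epsilon> n es = map_pmf maxest (run \<alpha> \<epsilon> n es init_state)"

end

theory Submission
  imports Defs
begin

text \<open>
  Which edges die and when is determined by the stream alone, so at time \<open>t\<close> the sample is the set of
  those alive edges that survived the coin flips. At rate \<open>q\<close> its size behaves like a binomial variable
  with \<open>card (E_alpha \<alpha> es t)\<close> trials and success probability \<open>q\<close>: a supermartingale bounds the moment
  generating function of the sample size on the event that the current rate is \<open>q\<close>, and Chernoff
  bounds follow, without coupling the run to independent random levels of the edges.

  Let \<open>K\<close> be the first level at which \<open>E_star / 2 ^ K\<close> is at most \<open>3 / 5\<close> of the threshold. If \<open>K = 0\<close>,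
  the sample never overflows and the output is exact. Otherwise the run succeeds unless the sample
  overflows at level \<open>K\<close>, or overestimates \<open>E_star\<close> by a factor \<open>1 + \<epsilon>\<close> at some time and some
  level up to \<open>K\<close>, or underestimates it at one fixed time at which \<open>E_star\<close> is attained. A union
  bound over times and levels gives failure probability at most \<open>1 / n\<close>.
\<close>

section \<open>Inequalities and probability preliminaries\<close>

lemma ln_add_one_ge_ratio:
  fixes x :: real
  assumes "0 \<le> x"
  shows "2 * x / (2 + x) \<le> ln (1 + x)"
proof -
  let ?g = "\<lambda>x::real. ln (1 + x) - 2 * x / (2 + x)"
  have "?g 0 \<le> ?g x"
  proof (rule DERIV_nonneg_imp_nondecreasing[OF assms])
    fix u :: real assume u: "0 \<le> u" "u \<le> x"
    have "(?g has_real_derivative 1 / (1 + u) - 4 / (2 + u)\<^sup>2) (at u)"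
      using u by (auto intro!: derivative_eq_intros simp: field_simps power2_eq_square)
    moreover have "1 / (1 + u) - 4 / (2 + u)\<^sup>2 = u\<^sup>2 / ((1 + u) * (2 + u)\<^sup>2)"
      using u by (simp add: divide_simps) (simp add: algebra_simps power2_eq_square)
    ultimately show "\<exists>y. (?g has_real_derivative y) (at u) \<and> 0 \<le> y"
      using u by (intro exI[of _ "1 / (1 + u) - 4 / (2 + u)\<^sup>2"]) simp
  qed
  then show ?thesis by simp
qed

text \<open>The difference of the two sides vanishes at 1 and has derivative
  \<open>- (1 - 1 / u)\<^sup>2 / 2\<close>. Multiplied by \<open>y\<close> the lower bound becomes
  polynomial, which suits the lower-tail exponent.\<close>

lemma ln_ge_half_diff_inverse:
  fixes y :: real
  assumes "0 < y" "y \<le> 1"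
  shows "(y - 1 / y) / 2 \<le> ln y"
proof -
  let ?g = "\<lambda>y::real. ln y - (y - 1 / y) / 2"
  have "?g 1 \<le> ?g y"
  proof (rule DERIV_nonpos_imp_nonincreasing[OF assms(2)])
    fix u :: real assume u: "y \<le> u" "u \<le> 1"
    then have "0 < u" using assms by simp
    have "(?g has_real_derivative - (1 - 1 / u)\<^sup>2 / 2) (at u)"
      using \<open>0 < u\<close> by (auto intro!: derivative_eq_intros simp: field_simps power2_eq_square)
    then show "\<exists>z. (?g has_real_derivative z) (at u) \<and> z \<le> 0"
      by (intro exI[of _ "- (1 - 1 / u)\<^sup>2 / 2"]) simp
  qed
  then show ?thesis by simp
qed

text \<open>The argument gives \<open>\<epsilon>\<^sup>2 / 2\<close>; it is weakened to the constant
  that the upper tail reaches, so that both tails share one estimate per level.\<close>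

lemma lower_tail_exponent:
  fixes \<epsilon> :: real
  assumes "0 < \<epsilon>" "\<epsilon> < 1"
  shows "9 / 25 * \<epsilon>\<^sup>2 \<le> (1 - \<epsilon>) * ln (1 - \<epsilon>) + \<epsilon>"
proof -
  have "(1 - \<epsilon>) * (((1 - \<epsilon>) - 1 / (1 - \<epsilon>)) / 2) \<le> (1 - \<epsilon>) * ln (1 - \<epsilon>)"
    using assms by (intro mult_left_mono ln_ge_half_diff_inverse) auto
  moreover have "(1 - \<epsilon>) * (((1 - \<epsilon>) - 1 / (1 - \<epsilon>)) / 2) + \<epsilon> = \<epsilon>\<^sup>2 / 2"
    using assms by (simp add: field_simps power2_eq_square)
  moreover have "9 / 25 * \<epsilon>\<^sup>2 \<le> \<epsilon>\<^sup>2 / 2"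
    by simp
  ultimately show ?thesis by linarith
qed

text \<open>The usual constant \<open>1 / 3\<close> leaves almost no slack in the union bound. Applying the rational
  lower bound of the logarithm to \<open>sqrt (1 + \<epsilon>)\<close> instead of \<open>1 + \<epsilon>\<close> improves it.\<close>

lemma upper_tail_exponent:
  fixes \<epsilon> :: real
  assumes "0 < \<epsilon>" "\<epsilon> < 1"
  shows "9 / 25 * \<epsilon>\<^sup>2 \<le> (1 + \<epsilon>) * ln (1 + \<epsilon>) - \<epsilon>"
proof -
  define s where "s = sqrt (1 + \<epsilon>)"
  have s2: "s\<^sup>2 = 1 + \<epsilon>" and s1: "1 \<le> s"
    using assms by (auto simp: s_def)
  \<comment> \<open>A rational upper bound for the square root of 2.\<close>
  have s_le: "s \<le> 283 / 200"
    by (rule power2_le_imp_le) (use s2 assms in \<open>auto simp: power2_eq_square\<close>)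
  have "2 * (2 * (s - 1) / (2 + (s - 1))) \<le> 2 * ln (1 + (s - 1))"
    using s1 by (intro mult_left_mono ln_add_one_ge_ratio) auto
  also have "\<dots> = ln (1 + \<epsilon>)"
    using s1 by (simp flip: s2 add: ln_realpow)
  finally have "s\<^sup>2 * (4 * (s - 1) / (s + 1)) \<le> s\<^sup>2 * ln (1 + \<epsilon>)"
    by (intro mult_left_mono) (auto simp: algebra_simps)
  moreover have "s\<^sup>2 * (4 * (s - 1) / (s + 1)) - (s\<^sup>2 - 1) = (s - 1)\<^sup>2 * ((3 * s + 1) / (s + 1))"
    using s1 by (simp add: divide_simps) (simp add: algebra_simps power2_eq_square)
  moreover have "(s - 1)\<^sup>2 * (9 / 25 * (s + 1)\<^sup>2) \<le> (s - 1)\<^sup>2 * ((3 * s + 1) / (s + 1))"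
  proof (intro mult_left_mono)
    \<comment> \<open>By convexity \<open>s\<^sup>2\<close> and \<open>s ^ 3\<close> lie below their
      chords over the interval from 1 to \<open>283 / 200\<close>, which makes the cubic inequality
      linear. The factor \<open>s + 483 / 200\<close> is the one that cancels the quadratic
      term.\<close>
    have a: "(s - 1) * (s - 283 / 200) \<le> 0"
      using s1 s_le by (intro mult_nonneg_nonpos) auto
    then have "(s + 483 / 200) * ((s - 1) * (s - 283 / 200)) \<le> 0"
      using s1 by (intro mult_nonneg_nonpos[OF _ a]) auto
    then have "s ^ 3 \<le> 176689 / 40000 * s - 136689 / 40000"
      by (simp add: field_simps power3_eq_cube)
    moreover have "s\<^sup>2 \<le> 483 / 200 * s - 283 / 200"
      using a by (simp add: field_simps power2_eq_square)
    moreover have "(s + 1) ^ 3 = s ^ 3 + 3 * s\<^sup>2 + 3 * s + 1"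
      by (simp add: algebra_simps power2_eq_square power3_eq_cube)
    ultimately have "9 / 25 * (s + 1) ^ 3 \<le> 3 * s + 1"
      using s_le by linarith
    then show "9 / 25 * (s + 1)\<^sup>2 \<le> (3 * s + 1) / (s + 1)"
      using s1 by (simp add: pos_le_divide_eq power2_eq_square power3_eq_cube mult_ac)
  qed simp
  moreover have "(s - 1)\<^sup>2 * (9 / 25 * (s + 1)\<^sup>2) = 9 / 25 * \<epsilon>\<^sup>2"
  proof -
    have "\<epsilon> = (s - 1) * (s + 1)" using s2 by (simp add: algebra_simps power2_eq_square)
    then show ?thesis by (simp add: power_mult_distrib)
  qed
  ultimately show ?thesis unfolding s2 by linarith
qed

text \<open>The rational bound applied at \<open>2 / 3\<close> yields only \<open>1 / 2\<close>,
  which would lower the overflow exponent to 3. Factoring brings the arguments closer to 0, where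
  the bound is sharper.\<close>

lemma ln_five_thirds_ge: "507 / 1000 \<le> ln (5 / 3 :: real)"
proof -
  have "ln (5 / 3 :: real) = ln ((1 + 1 / 4) * (1 + 1 / 3))" by simp
  also have "\<dots> = ln (1 + 1 / 4) + ln (1 + 1 / 3)" by (rule ln_mult_pos) auto
  finally show ?thesis
    using ln_add_one_ge_ratio[of "1 / 4"] ln_add_one_ge_ratio[of "1 / 3"] by simp
qed

lemma prob_bind_le:
  assumes "\<And>x y. x \<in> set_pmf M \<Longrightarrow> x \<notin> A \<Longrightarrow> y \<in> set_pmf (f x) \<Longrightarrow> y \<in> B \<Longrightarrow> y \<in> B'"
  shows "measure_pmf.prob (bind_pmf M f) B
    \<le> measure_pmf.prob M A + measure_pmf.prob (bind_pmf M f) B'"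
proof -
  have "emeasure (bind_pmf M f) B = (\<integral>\<^sup>+x. emeasure (f x) B \<partial>M)" by simp
  also have "\<dots> \<le> (\<integral>\<^sup>+x. indicator A x + emeasure (f x) B' \<partial>M)"
  proof (intro nn_integral_mono_AE AE_pmfI)
    fix x assume x: "x \<in> set_pmf M"
    show "emeasure (f x) B \<le> indicator A x + emeasure (f x) B'"
    proof (cases "x \<in> A")
      case True
      have "emeasure (f x) B \<le> 1" by (rule measure_pmf.emeasure_le_1)
      also have "\<dots> \<le> 1 + emeasure (f x) B'" by simp
      finally show ?thesis using True by simp
    next
      case False
      have "emeasure (f x) B \<le> emeasure (f x) B'"
        by (intro emeasure_mono_AE AE_pmfI) (use assms x False in auto)
      then show ?thesis using False by simp
    qed
  qed
  also have "\<dots> = emeasure M A + emeasure (bind_pmf M f) B'"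
    by (subst nn_integral_add) auto
  finally show ?thesis
    by (simp add: measure_pmf.emeasure_eq_measure ennreal_plus[symmetric] del: ennreal_plus emeasure_bind_pmf)
qed

lemma prob_Markov_nn_integral:
  assumes "(\<integral>\<^sup>+x. ennreal (f x) \<partial>measure_pmf M) \<le> ennreal v" and "0 < b" and "0 \<le> v"
    and "\<And>x. x \<in> set_pmf M \<Longrightarrow> x \<in> A \<Longrightarrow> b \<le> f x"
  shows "measure_pmf.prob M A \<le> v / b"
proof -
  have "ennreal (b * measure_pmf.prob M A) = (\<integral>\<^sup>+x. ennreal b * indicator A x \<partial>M)"
    using assms(2) by (simp add: nn_integral_cmult_indicator measure_pmf.emeasure_eq_measure ennreal_mult)
  also have "\<dots> \<le> (\<integral>\<^sup>+x. ennreal (f x) \<partial>M)"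
    by (intro nn_integral_mono_AE AE_pmfI) (use assms(4) in \<open>auto simp: indicator_def intro!: ennreal_leI\<close>)
  also note assms(1)
  finally show ?thesis using assms(2,3) by (simp add: pos_le_divide_eq mult.commute)
qed

lemma nn_integral_bernoulli_pmf_ennreal:
  fixes f :: "bool \<Rightarrow> real"
  assumes "0 \<le> p" "p \<le> 1" "\<And>b. 0 \<le> f b"
  shows "(\<integral>\<^sup>+b. ennreal (f b) \<partial>bernoulli_pmf p) = ennreal (f True * p + f False * (1 - p))"
  using assms by (subst nn_integral_bernoulli_pmf) (auto simp: ennreal_mult)

text \<open>By independence the integral factorises: the coin of an element of
  \<open>S \<inter> D\<close> contributes the mean of 1 and \<open>x\<close>, every other coin
  contributes 1.\<close>

lemma nn_integral_power_card_fair_coins: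
  fixes x :: real
  assumes "finite S" "0 \<le> x"
  shows "(\<integral>\<^sup>+keep. ennreal (x ^ card ({e \<in> S. keep e} \<inter> D))
      \<partial>Pi_pmf S False (\<lambda>_. bernoulli_pmf (1 / 2))) = ennreal (((1 + x) / 2) ^ card (S \<inter> D))"
proof -
  let ?f = "\<lambda>e b. ennreal (if e \<in> D \<and> b then x else 1)"
  have "ennreal (x ^ card ({e \<in> S. keep e} \<inter> D)) = (\<Prod>e\<in>S. ?f e (keep e))" for keep
  proof -
    have "(\<Prod>e\<in>S. (if e \<in> D \<and> keep e then x else 1)) = (\<Prod>e\<in>{e \<in> S. keep e} \<inter> D. x)"
      using assms(1) by (intro prod.mono_neutral_cong_right) auto
    then show ?thesis using assms(2) by (subst prod_ennreal) auto
  qed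
  then have "(\<integral>\<^sup>+keep. ennreal (x ^ card ({e \<in> S. keep e} \<inter> D))
      \<partial>Pi_pmf S False (\<lambda>_. bernoulli_pmf (1 / 2)))
    = (\<Prod>e\<in>S. \<integral>\<^sup>+b. ?f e b \<partial>bernoulli_pmf (1 / 2))"
    by (simp only:) (rule nn_integral_prod_Pi_pmf[OF assms(1)])
  also have "\<dots> = (\<Prod>e\<in>S. ennreal (if e \<in> D then (1 + x) / 2 else 1))"
    using assms(2)
    by (intro prod.cong refl) (subst nn_integral_bernoulli_pmf_ennreal, auto simp: field_simps)
  also have "\<dots> = ennreal (\<Prod>e\<in>S. if e \<in> D then (1 + x) / 2 else 1)"
    using assms(2) by (subst prod_ennreal) auto
  also have "(\<Prod>e\<in>S. if e \<in> D then (1 + x) / 2 else 1) = (\<Prod>e\<in>S \<inter> D. (1 + x) / 2)"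
    using assms(1) by (intro prod.mono_neutral_cong_right) auto
  finally show ?thesis by simp
qed

lemma one_plus_mult_nonneg: "0 \<le> (a::real) \<Longrightarrow> a \<le> 1 \<Longrightarrow> - 1 \<le> c \<Longrightarrow> 0 \<le> 1 + a * c"
  using mult_left_mono[of "- 1" c a] by simp

lemma one_plus_power_le_exp:
  fixes x :: real
  assumes "- 1 \<le> x"
  shows "(1 + x) ^ k \<le> exp (real k * x)"
  using power_mono[OF exp_ge_add_one_self[of x], of k] assms by (simp add: exp_of_nat_mult)

lemma bernoulli_one: "b \<in> set_pmf (bernoulli_pmf 1) \<Longrightarrow> b"
  by (cases b) (auto simp: set_pmf_iff)

lemma sum_powers_le:
  fixes r :: real
  assumes "0 \<le> r" "r < 1"
  shows "(\<Sum>j\<le>K. r ^ Suc j) \<le> r / (1 - r)"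
proof -
  have "(\<Sum>j\<le>K. r ^ Suc j) = r * (\<Sum>j<Suc K. r ^ j)"
    by (simp add: sum_distrib_left lessThan_Suc_atMost)
  also have "\<dots> = r * ((1 - r ^ Suc K) / (1 - r))"
    using assms by (subst sum_gp_strict) auto
  also have "\<dots> \<le> r * (1 / (1 - r))"
    using assms by (intro mult_left_mono divide_right_mono) auto
  finally show ?thesis by simp
qed

lemma exp_minus_le_inverse:
  fixes x :: real
  assumes "0 \<le> x"
  shows "exp (- x) \<le> 1 / (1 + x)"
  using exp_ge_add_one_self[of x] assms by (simp add: exp_minus field_simps)

text \<open>As \<open>2 ^ j\<close> is at least \<open>j + 1\<close>, the failure probabilities of
  the levels are dominated by a geometric series.\<close>

lemma exp_level_bound:
  fixes x :: real
  assumes "0 \<le> x"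
  shows "exp (- (x * 2 ^ j)) \<le> exp (- x) ^ Suc j"
proof -
  have "real (Suc j) \<le> 2 ^ j"
    using less_exp[of j] by (metis Suc_leI of_nat_le_iff of_nat_numeral of_nat_power)
  then have "x * real (Suc j) \<le> x * 2 ^ j"
    using assms by (rule mult_left_mono)
  then have "exp (- (x * 2 ^ j)) \<le> exp (real (Suc j) * - x)"
    by (simp only: exp_le_cancel_iff) (simp add: algebra_simps)
  then show ?thesis by (simp only: exp_of_nat_mult)
qed

text \<open>Here \<open>r\<close> is n to the power -16/5, so \<open>n ^ 2 * r\<close> is
  \<open>1 / n\<close> times n to the power -1/5. For \<open>L\<close> at least \<open>4 / 3\<close>
  this spare factor is at most \<open>4 / 5\<close> and pays for \<open>1 / (1 - r)\<close>.\<close>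

lemma union_bound_numeric:
  fixes L :: real
  assumes "4 / 3 \<le> L" "L = ln (real n)" "0 < n" and m: "real m + 1 \<le> real n ^ 2 / 2"
  defines "r \<equiv> exp (- (16 / 5 * L))"
  shows "r < 1" "real m * (r + r / (1 - r)) + r / (1 - r) \<le> 1 / real n"
proof -
  have "exp (- (16 / 5 * L)) \<le> 1 / (1 + 16 / 5 * L)"
    using assms(1) by (intro exp_minus_le_inverse) auto
  also have "\<dots> \<le> 1 / 5"
    using assms(1) by (intro divide_left_mono) auto
  finally have r: "r \<le> 1 / 5" by (simp add: r_def)
  then show "r < 1" by simp
  have r0: "0 < r" by (simp add: r_def)
  have "exp (- (1 / 5 * L)) \<le> 1 / (1 + 1 / 5 * L)"
    using assms(1) by (intro exp_minus_le_inverse) auto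
  also have "\<dots> \<le> 1 / (1 + 1 / 5 * (4 / 3))"
    using assms(1) by (intro divide_left_mono) auto
  finally have x: "exp (- (1 / 5 * L)) \<le> 4 / 5" by simp
  have n: "exp L = real n" using assms by simp
  have "r \<le> r / (1 - r)" using r r0 by (simp add: field_simps)
  then have "real m * (r + r / (1 - r)) + r / (1 - r) \<le> real m * (2 * (r / (1 - r))) + 2 * (r / (1 - r))"
    using r r0 by (intro add_mono mult_left_mono) auto
  also have "\<dots> = (real m + 1) * (2 * (r / (1 - r)))"
    by (simp only: distrib_right mult_1_left)
  also have "\<dots> \<le> real n ^ 2 / 2 * (2 * (r / (1 - r)))"
    using m r r0 by (intro mult_right_mono) auto
  also have "\<dots> = real n ^ 2 * r / (1 - r)"
    by simp
  also have "real n ^ 2 * r = exp (- (1 / 5 * L)) / real n"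
  proof -
    have "real n ^ 2 * r = exp (2 * L + - (16 / 5 * L))"
      unfolding r_def exp_add using n by (simp add: exp_double)
    also have "2 * L + - (16 / 5 * L) = - (1 / 5 * L) - L" by simp
    finally show ?thesis by (simp only: exp_diff n)
  qed
  also have "exp (- (1 / 5 * L)) / real n / (1 - r) \<le> (4 / 5) / real n / (4 / 5)"
    using x r by (intro frac_le divide_right_mono) auto
  finally show "real m * (r + r / (1 - r)) + r / (1 - r) \<le> 1 / real n" by simp
qed

section \<open>Runs of the algorithm\<close>

lemma finite_E_alpha [simp]: "finite (E_alpha \<alpha> es t)"
  unfolding E_alpha_def by (rule finite_subset[of _ "(!) es ` {..<t}"]) auto

lemma card_E_alpha_le_E_star:
  assumes "t \<le> length es"
  shows "card (E_alpha \<alpha> es t) \<le> E_star \<alpha> es"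
proof (cases t)
  case 0
  then show ?thesis by (simp add: E_alpha_def)
next
  case (Suc u)
  then show ?thesis unfolding E_star_def using assms by (intro Max_ge) auto
qed

lemma E_star_attained:
  assumes "0 < E_star \<alpha> es"
  obtains t where "1 \<le> t" "t \<le> length es" "card (E_alpha \<alpha> es t) = E_star \<alpha> es"
proof -
  have "E_star \<alpha> es \<in> insert 0 ((\<lambda>t. card (E_alpha \<alpha> es t)) ` {1..length es})"
    unfolding E_star_def by (rule Max_in) auto
  with assms that show ?thesis by auto
qed

lemma card_E_alpha_le: "card (E_alpha \<alpha> es t) \<le> t"
proof -
  have "card (E_alpha \<alpha> es t) \<le> card ((!) es ` {..<t})"
    unfolding E_alpha_def by (intro card_mono) auto
  also have "\<dots> \<le> t" using card_image_le[of "{..<t}"] by simp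
  finally show ?thesis .
qed

lemma run_append:
  "run \<alpha> \<epsilon> n (xs @ ys) st = bind_pmf (run \<alpha> \<epsilon> n xs st) (run \<alpha> \<epsilon> n ys)"
  by (induction xs arbitrary: st) (auto simp: bind_return_pmf bind_assoc_pmf)

lemma run_single: "run \<alpha> \<epsilon> n [e] = step \<alpha> \<epsilon> n e"
  by (rule ext) (simp add: bind_return_pmf')

locale edge_sampling =
  fixes \<alpha> :: nat and \<epsilon> :: real and n :: nat and es :: "'a set list"
  assumes distinct_es: "distinct es"
begin

abbreviation alive :: "nat \<Rightarrow> 'a set set" where
  "alive \<equiv> E_alpha \<alpha> es"

definition threshold :: real where
  "threshold = 30 * (1 / \<epsilon>\<^sup>2) * ln (real n)"

section \<open>Life span of an edge, read off the stream\<close>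

definition later_degree :: "nat \<Rightarrow> 'a \<Rightarrow> nat \<Rightarrow> nat" where
  "later_degree i w s = card {j. i < j \<and> j < s \<and> w \<in> es ! j}"

lemma later_degree_Suc:
  assumes "i < s"
  shows "later_degree i w (Suc s) = later_degree i w s + (if w \<in> es ! s then 1 else 0)"
proof -
  have "{j. i < j \<and> j < Suc s \<and> w \<in> es ! j}
    = {j. i < j \<and> j < s \<and> w \<in> es ! j} \<union> (if w \<in> es ! s then {s} else {})"
    using assms by (auto simp: less_Suc_eq)
  then show ?thesis by (auto simp: later_degree_def)
qed

lemma later_degree_mono: "s \<le> t \<Longrightarrow> later_degree i w s \<le> later_degree i w t"
  unfolding later_degree_def by (intro card_mono) auto

lemma nth_eq_stream: "i < length es \<Longrightarrow> j < length es \<Longrightarrow> es ! i = es ! j \<longleftrightarrow> i = j"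
  using distinct_es by (simp add: nth_eq_iff_index_eq)

lemma alive_iff:
  assumes "i < s" "s \<le> length es"
  shows "es ! i \<in> alive s \<longleftrightarrow> (\<forall>w\<in>es ! i. later_degree i w s \<le> \<alpha>)"
proof -
  have "i' = i" if "i' < s" "es ! i = es ! i'" for i'
    using that assms nth_eq_stream[of i i'] by auto
  then show ?thesis using assms unfolding E_alpha_def later_degree_def by blast
qed

lemma aliveE:
  assumes "e \<in> alive s"
  obtains i where "i < s" "e = es ! i"
  using assms by (auto simp: E_alpha_def)

lemma alive_0 [simp]: "alive 0 = {}"
  by (auto simp: E_alpha_def)

lemma newest_alive: "es ! s \<in> alive (Suc s)"
proof -
  have *: "card {j. s < j \<and> j < Suc s \<and> w \<in> es ! j} = 0" for w by auto
  show ?thesis unfolding E_alpha_def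
    by (intro CollectI exI[of _ s] conjI ballI) (simp_all only: * le0 lessI)
qed

lemma newest_not_alive:
  assumes "s < length es"
  shows "es ! s \<notin> alive s"
proof
  assume "es ! s \<in> alive s"
  then obtain i where "i < s" "es ! s = es ! i" by (rule aliveE)
  then show False using assms nth_eq_stream[of s i] by simp
qed

text \<open>Later degrees only grow with time, so an arrived edge that has died stays dead.\<close>

lemma alive_antimono:
  assumes "i < s" "s \<le> t" "t \<le> length es" "es ! i \<in> alive t"
  shows "es ! i \<in> alive s"
  using assms alive_iff[of i s] alive_iff[of i t] later_degree_mono[OF assms(2)]
  by (meson le_trans less_le_trans)

lemma alive_Suc_subset:
  assumes "s < length es"
  shows "alive (Suc s) \<subseteq> insert (es ! s) (alive s)"
proof
  fix e assume e: "e \<in> alive (Suc s)"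
  then obtain i where "i < Suc s" "e = es ! i" by (rule aliveE)
  with e assms alive_antimono[of i s "Suc s"] show "e \<in> insert (es ! s) (alive s)"
    by (auto simp: less_Suc_eq)
qed

text \<open>Counters are fixed only on sampled edges, since those of dropped edges are stale. At
  rate 1 no edge has been lost to a coin, so the sample is deterministic.\<close>

definition invariant :: "nat \<Rightarrow> 'a state \<Rightarrow> bool" where
  "invariant s st \<longleftrightarrow> sample st \<subseteq> alive s
    \<and> (\<forall>i<s. es ! i \<in> sample st \<longrightarrow> (\<forall>w\<in>es ! i. counter st (es ! i) w = later_degree i w s))
    \<and> (\<exists>k. rate st = 1 / 2 ^ k)
    \<and> (rate st = 1 \<longrightarrow> sample st = alive s)"

lemma invariant_sample: "invariant s st \<Longrightarrow> sample st \<subseteq> alive s"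
  and invariant_finite: "invariant s st \<Longrightarrow> finite (sample st)"
  and invariant_rate: "invariant s st \<Longrightarrow> \<exists>k. rate st = 1 / 2 ^ k"
  and invariant_rate_pos: "invariant s st \<Longrightarrow> 0 < rate st"
  and invariant_rate_le: "invariant s st \<Longrightarrow> rate st \<le> 1"
  and invariant_full: "invariant s st \<Longrightarrow> rate st = 1 \<Longrightarrow> sample st = alive s"
  by (auto simp: invariant_def intro: finite_subset)

definition insert_edge :: "nat \<Rightarrow> bool \<Rightarrow> 'a state \<Rightarrow> 'a state" where
  "insert_edge s b st = update_counters \<alpha> (es ! s)
    (if b then st\<lparr>sample := insert (es ! s) (sample st), counter := (counter st)(es ! s := (\<lambda>_. 0))\<rparr>
     else st)"

lemma rate_insert_edge [simp]: "rate (insert_edge s b st) = rate st"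
  and maxest_insert_edge [simp]: "maxest (insert_edge s b st) = maxest st"
  by (simp_all add: insert_edge_def update_counters_def Let_def)

text \<open>For a sampled edge the counters are its later degrees. They change only at endpoints
  shared with \<open>es ! s\<close>, so exceeding \<open>\<alpha>\<close> there is exactly dying at
  time \<open>Suc s\<close>.\<close>

lemma sample_insert_edge:
  assumes inv: "invariant s st" and s: "s < length es"
  shows "sample (insert_edge s b st)
    = (if b then insert (es ! s) (sample st) else sample st) \<inter> alive (Suc s)"
proof (intro set_eqI)
  fix e
  let ?S = "if b then insert (es ! s) (sample st) else sample st"
  have notin: "es ! s \<notin> sample st"
    using newest_not_alive[OF s] invariant_sample[OF inv] by blast
  show "e \<in> sample (insert_edge s b st) \<longleftrightarrow> e \<in> ?S \<inter> alive (Suc s)"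
  proof (cases "e \<in> sample st")
    case False
    then show ?thesis
      using newest_alive[of s] by (auto simp: insert_edge_def update_counters_def Let_def)
  next
    case True
    then obtain i where i: "i < s" "e = es ! i"
      using invariant_sample[OF inv] by (blast elim: aliveE)
    have ne: "e \<noteq> es ! s" using True notin by auto
    have cnt: "counter st e w = later_degree i w s" if "w \<in> e" for w
      using inv i True that by (auto simp: invariant_def)
    have "later_degree i w s \<le> \<alpha>" if "w \<in> e" for w
      using alive_iff[of i s] i s True invariant_sample[OF inv] that by auto
    moreover have "e \<in> alive (Suc s) \<longleftrightarrow> (\<forall>w\<in>e. later_degree i w (Suc s) \<le> \<alpha>)"
      using alive_iff[of i "Suc s"] i s by auto
    ultimately have "e \<in> alive (Suc s) \<longleftrightarrow> \<not> (\<exists>w\<in>e \<inter> es ! s. later_degree i w s + 1 > \<alpha>)"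
      by (auto simp: later_degree_Suc[OF i(1)] not_less split: if_splits)
    moreover have "e \<in> sample (insert_edge s b st)
        \<longleftrightarrow> \<not> (\<exists>w\<in>e \<inter> es ! s. counter st e w + 1 > \<alpha>)"
      using True ne by (auto simp: insert_edge_def update_counters_def Let_def)
    ultimately show ?thesis using True cnt by auto
  qed
qed

lemma invariant_insert_edge:
  assumes inv: "invariant s st" and s: "s < length es" and b: "rate st = 1 \<Longrightarrow> b"
  shows "invariant (Suc s) (insert_edge s b st)"
proof -
  let ?st = "insert_edge s b st"
  note smp = sample_insert_edge[OF inv s, of b]
  have notin: "es ! s \<notin> sample st"
    using newest_not_alive[OF s] invariant_sample[OF inv] by blast
  have "counter ?st (es ! i) w = later_degree i w (Suc s)"
    if i: "i < Suc s" and mem: "es ! i \<in> sample ?st" and w: "w \<in> es ! i" for i w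
  proof (cases "i = s")
    case True
    then have "b" using mem smp notin by (auto split: if_splits)
    moreover have "later_degree s w (Suc s) = 0" by (auto simp: later_degree_def)
    ultimately show ?thesis
      using True by (simp add: insert_edge_def update_counters_def Let_def)
  next
    case False
    then have i: "i < s" using i by simp
    then have ne: "es ! i \<noteq> es ! s" using s nth_eq_stream[of i s] by auto
    then have "es ! i \<in> sample st" using mem smp by (auto split: if_splits)
    then have "counter st (es ! i) w = later_degree i w s"
      using inv i w by (auto simp: invariant_def)
    then show ?thesis
      using ne i w \<open>es ! i \<in> sample st\<close> later_degree_Suc[OF i]
      by (auto simp: insert_edge_def update_counters_def Let_def)
  qed
  moreover have "sample ?st = alive (Suc s)" if "rate ?st = 1"
    using smp b that invariant_full[OF inv] alive_Suc_subset[OF s] by auto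
  ultimately show ?thesis
    using inv smp by (auto simp: invariant_def)
qed

text \<open>A step is cut just before the subsampling because overflow is an event of that
  intermediate state. Its time index is already \<open>Suc s\<close>, as the edge
  \<open>es ! s\<close> has arrived.\<close>

definition pre_step :: "nat \<Rightarrow> 'a state \<Rightarrow> 'a state pmf" where
  "pre_step s st = map_pmf (\<lambda>b. insert_edge s b st) (bernoulli_pmf (rate st))"

definition post_step :: "'a state \<Rightarrow> 'a state pmf" where
  "post_step st = map_pmf update_max (subsample \<epsilon> n st)"

definition state_at :: "nat \<Rightarrow> 'a state pmf" where
  "state_at s = run \<alpha> \<epsilon> n (take s es) init_state"

definition pre_state_at :: "nat \<Rightarrow> 'a state pmf" where
  "pre_state_at s = bind_pmf (state_at s) (pre_step s)"

lemma state_at_0: "state_at 0 = return_pmf init_state"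
  by (simp add: state_at_def)

lemma step_eq: "step \<alpha> \<epsilon> n (es ! s) = (\<lambda>st. bind_pmf (pre_step s st) post_step)"
  by (rule ext) (simp add: step_def add_edge_def pre_step_def post_step_def insert_edge_def
      map_pmf_def bind_assoc_pmf bind_return_pmf)

lemma state_at_Suc:
  assumes "s < length es"
  shows "state_at (Suc s) = bind_pmf (pre_state_at s) post_step"
  using assms
  by (simp del: run.simps add: state_at_def pre_state_at_def take_Suc_conv_app_nth run_append
      run_single step_eq bind_assoc_pmf)

lemma invariant_pre_step:
  assumes "invariant s st" "s < length es" "st' \<in> set_pmf (pre_step s st)"
  shows "invariant (Suc s) st'"
  using assms by (auto simp: pre_step_def dest: bernoulli_one intro!: invariant_insert_edge)

lemma post_step_cases:
  assumes "st' \<in> set_pmf (post_step st)"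
  obtains "real (card (sample st)) \<le> threshold" "st' = update_max st"
  | keep where "threshold < real (card (sample st))"
      "st' = update_max (st\<lparr>sample := {e \<in> sample st. keep e}, rate := rate st / 2\<rparr>)"
  using assms by (auto simp: post_step_def subsample_def threshold_def split: if_splits)

lemma invariant_post_step:
  assumes inv: "invariant s st" and mem: "st' \<in> set_pmf (post_step st)"
  shows "invariant s st'"
  using mem
proof (cases rule: post_step_cases)
  case 1
  then show ?thesis using inv by (simp add: invariant_def update_max_def)
next
  case (2 keep)
  have "\<exists>k. rate st / 2 = 1 / 2 ^ k"
    using invariant_rate[OF inv] by (metis divide_divide_eq_left mult.commute power_Suc)
  moreover have "rate st / 2 \<noteq> 1"
    using invariant_rate_le[OF inv] by simp
  ultimately show ?thesis using 2 inv by (auto simp: invariant_def update_max_def)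
qed

lemma invariant_init: "invariant 0 init_state"
  by (auto simp: invariant_def init_state_def intro: exI[of _ 0])

lemma invariant_state_at:
  assumes "s \<le> length es" "st \<in> set_pmf (state_at s)"
  shows "invariant s st"
  using assms
proof (induction s arbitrary: st)
  case 0
  then show ?case by (simp add: state_at_0 invariant_init)
next
  case (Suc s)
  then obtain x y where "x \<in> set_pmf (state_at s)" "y \<in> set_pmf (pre_step s x)"
      "st \<in> set_pmf (post_step y)"
    by (auto simp: state_at_Suc pre_state_at_def)
  with Suc show ?case
    using invariant_pre_step[of s x y] invariant_post_step[of "Suc s" y st] by auto
qed

lemma invariant_pre_state_at:
  assumes "s < length es" "st \<in> set_pmf (pre_state_at s)"
  shows "invariant (Suc s) st"
  using assms invariant_pre_step[OF invariant_state_at] by (auto simp: pre_state_at_def)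

lemma maxest_post_step:
  assumes "st' \<in> set_pmf (post_step st)"
  shows "maxest st' = max (maxest st) (real (card (sample st')) / rate st')"
  using assms by (cases rule: post_step_cases) (auto simp: update_max_def)

section \<open>Chernoff bounds for the sample size\<close>

text \<open>If the rate were lowered to exactly \<open>q\<close> by time \<open>t\<close> no matter what, each sampled edge that is
  still alive at time \<open>t\<close> would stay in the sample with probability \<open>q / rate st\<close> and each edge yet
  to come would be there with probability \<open>q\<close>; the product below is then the conditional expectation
  of \<open>(1 + c) ^ card (sample st')\<close> for the state \<open>st'\<close> at time \<open>t\<close>. Lowering the rate below \<open>q\<close> only
  loses mass, which makes this a supermartingale.\<close>

definition potential :: "nat \<Rightarrow> real \<Rightarrow> real \<Rightarrow> nat \<Rightarrow> 'a state \<Rightarrow> real" where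
  "potential t q c s st = (if rate st < q then 0
     else (1 + q / rate st * c) ^ card (sample st \<inter> alive t)
        * (1 + q * c) ^ card (alive t \<inter> set (drop s es)))"

lemma potential_nonneg:
  assumes "0 < q" "q \<le> 1" "- 1 \<le> c"
  shows "0 \<le> potential t q c s st"
proof (cases "rate st < q")
  case False
  have "0 \<le> 1 + q / rate st * c" "0 \<le> 1 + q * c"
    using assms False by (intro one_plus_mult_nonneg; simp)+
  then show ?thesis by (simp add: potential_def del: times_divide_eq_left)
qed (simp add: potential_def)

text \<open>With \<open>p = rate st\<close>, an edge \<open>es ! s\<close> alive at time
  \<open>t\<close> enters with probability \<open>p\<close> and then contributes
  \<open>1 + q / p * c\<close>, otherwise 1. The mean is \<open>1 + q * c\<close>, the factor it
  carried as an edge yet to come.\<close>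

lemma potential_pre_step:
  assumes inv: "invariant s st" and s: "Suc s \<le> t" "t \<le> length es"
    and q: "0 < q" "q \<le> 1" and c: "- 1 \<le> c"
  shows "(\<integral>\<^sup>+st'. ennreal (potential t q c (Suc s) st') \<partial>pre_step s st) = ennreal (potential t q c s st)"
proof -
  have s_len: "s < length es" using s by simp
  let ?e = "es ! s" and ?p = "rate st" and ?A = "alive t"
  let ?X = "1 + q / ?p * c" and ?Y = "1 + q * c"
  have drop: "drop s es = ?e # drop (Suc s) es"
    using s_len by (simp add: Cons_nth_drop_Suc)
  moreover have "distinct (drop s es)"
    using distinct_es by simp
  ultimately have e_drop: "?e \<notin> set (drop (Suc s) es)" by simp
  have e_sample: "?e \<notin> sample st"
    using newest_not_alive[OF s_len] invariant_sample[OF inv] by blast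
  \<comment> \<open>An edge alive at \<open>t\<close> is alive at \<open>Suc s\<close>, so the
    removals of this step are invisible to the potential.\<close>
  have smp: "sample (insert_edge s b st) \<inter> ?A = (if b then insert ?e (sample st) else sample st) \<inter> ?A"
    (is "_ = ?S b \<inter> ?A") for b
  proof -
    have "e \<in> alive (Suc s)" if "e \<in> ?S b" "e \<in> ?A" for e
    proof -
      have "e = es ! s \<or> e \<in> alive s"
        using that(1) invariant_sample[OF inv] by (auto split: if_splits)
      then obtain i where "i < Suc s" "e = es ! i"
        by (metis aliveE less_SucI lessI)
      then show ?thesis using alive_antimono[of i "Suc s" t] that s by simp
    qed
    then show ?thesis unfolding sample_insert_edge[OF inv s_len] by blast
  qed
  have "(\<integral>\<^sup>+st'. ennreal (potential t q c (Suc s) st') \<partial>pre_step s st)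
    = ennreal (potential t q c (Suc s) (insert_edge s True st) * ?p
        + potential t q c (Suc s) (insert_edge s False st) * (1 - ?p))"
    unfolding pre_step_def nn_integral_map_pmf
    using invariant_rate_pos[OF inv] invariant_rate_le[OF inv] potential_nonneg[OF q c]
    by (intro nn_integral_bernoulli_pmf_ennreal) auto
  also have "potential t q c (Suc s) (insert_edge s True st) * ?p
        + potential t q c (Suc s) (insert_edge s False st) * (1 - ?p) = potential t q c s st"
  proof (cases "?p < q")
    case True
    then show ?thesis by (simp add: potential_def)
  next
    case False
    let ?d = "card (?A \<inter> set (drop (Suc s) es))" and ?a = "card (sample st \<inter> ?A)"
    show ?thesis
    proof (cases "?e \<in> ?A")
      case True
      have "card (insert ?e (sample st) \<inter> ?A) = Suc ?a"
        using True e_sample invariant_finite[OF inv] by (simp add: Int_insert_left)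
      moreover have "card (?A \<inter> set (drop s es)) = Suc ?d"
        unfolding drop using True e_drop by (simp add: Int_insert_right)
      ultimately have "potential t q c (Suc s) (insert_edge s True st) * ?p
          + potential t q c (Suc s) (insert_edge s False st) * (1 - ?p)
          = ?X ^ ?a * ?Y ^ ?d * (1 + ?p * (q / ?p * c))"
        using False smp[of True] smp[of False] by (simp add: potential_def algebra_simps)
      also have "\<dots> = ?X ^ ?a * ?Y ^ Suc ?d"
        using invariant_rate_pos[OF inv] by simp
      finally show ?thesis
        using False \<open>card (?A \<inter> set (drop s es)) = Suc ?d\<close> by (simp add: potential_def)
    next
      assume e: "?e \<notin> ?A"
      then have "insert ?e (sample st) \<inter> ?A = sample st \<inter> ?A"
        "?A \<inter> set (drop s es) = ?A \<inter> set (drop (Suc s) es)"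
        unfolding drop by auto
      then show ?thesis
        using False smp[of True] smp[of False] by (simp add: potential_def algebra_simps)
    qed
  qed
  finally show ?thesis .
qed

lemma potential_update_max [simp]: "potential t q c s (update_max st) = potential t q c s st"
  by (simp add: potential_def update_max_def)

text \<open>Halving replaces the factor of a sampled edge by 1 or by
  \<open>1 + 2 * (q / rate st) * c\<close>, whose mean is the old factor. If halving takes the rate
  below \<open>q\<close>, the potential drops to 0; without halving it is unchanged.\<close>

lemma potential_post_step:
  assumes inv: "invariant s st" and q: "0 < q" "q \<le> 1" and c: "- 1 \<le> c"
  shows "(\<integral>\<^sup>+st'. ennreal (potential t q c s st') \<partial>post_step st) \<le> ennreal (potential t q c s st)"
proof (cases "real (card (sample st)) > threshold \<and> q \<le> rate st / 2")
  case False
  then show ?thesis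
    by (auto simp: post_step_def subsample_def threshold_def potential_def update_max_def)
next
  case True
  let ?p = "rate st" and ?Y = "(1 + q * c) ^ card (alive t \<inter> set (drop s es))"
  let ?X = "1 + q / (?p / 2) * c" and ?M = "Pi_pmf (sample st) False (\<lambda>_. bernoulli_pmf (1 / 2))"
  have p: "0 < ?p" by (rule invariant_rate_pos[OF inv])
  have X: "0 \<le> ?X" using True q c p by (intro one_plus_mult_nonneg) (auto simp: field_simps)
  have Y: "0 \<le> ?Y" using q c by (intro zero_le_power one_plus_mult_nonneg) auto
  have "(\<integral>\<^sup>+st'. ennreal (potential t q c s st') \<partial>post_step st)
    = (\<integral>\<^sup>+keep. ennreal (?X ^ card ({e \<in> sample st. keep e} \<inter> alive t)) * ennreal ?Y \<partial>?M)"
  proof -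
    have "ennreal (potential t q c s (st\<lparr>sample := S, rate := ?p / 2\<rparr>))
        = ennreal (?X ^ card (S \<inter> alive t)) * ennreal ?Y" for S
      using True X Y by (simp add: potential_def flip: ennreal_mult)
    then show ?thesis
      using True by (simp add: post_step_def subsample_def threshold_def)
  qed
  also have "\<dots> = ennreal (((1 + ?X) / 2) ^ card (sample st \<inter> alive t)) * ennreal ?Y"
    by (simp add: nn_integral_multc nn_integral_power_card_fair_coins[OF invariant_finite[OF inv] X]
        del: times_divide_eq_left times_divide_eq_right divide_divide_eq_right)
  also have "(1 + ?X) / 2 = 1 + q / ?p * c"
    by (simp add: field_simps)
  also have "ennreal ((1 + q / ?p * c) ^ card (sample st \<inter> alive t)) * ennreal ?Y
      = ennreal (potential t q c s st)"
    using True q c p Y by (simp add: potential_def ennreal_mult'')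
  finally show ?thesis by simp
qed

lemma potential_state_at:
  assumes "s \<le> t" "t \<le> length es" and q: "0 < q" "q \<le> 1" and c: "- 1 \<le> c"
  shows "(\<integral>\<^sup>+st. ennreal (potential t q c s st) \<partial>state_at s) \<le> ennreal ((1 + q * c) ^ card (alive t))"
  and "s < t \<Longrightarrow> (\<integral>\<^sup>+st. ennreal (potential t q c (Suc s) st) \<partial>pre_state_at s)
    \<le> ennreal ((1 + q * c) ^ card (alive t))"
proof -
  let ?B = "ennreal ((1 + q * c) ^ card (alive t))"
  have pre: "(\<integral>\<^sup>+st. ennreal (potential t q c (Suc s) st) \<partial>pre_state_at s) \<le> ?B"
    if "(\<integral>\<^sup>+st. ennreal (potential t q c s st) \<partial>state_at s) \<le> ?B" and s: "s < t" for s
  proof -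
    have "(\<integral>\<^sup>+st. ennreal (potential t q c (Suc s) st) \<partial>pre_state_at s)
      = (\<integral>\<^sup>+st. ennreal (potential t q c s st) \<partial>state_at s)"
      unfolding pre_state_at_def nn_integral_bind_pmf
      using s assms(2) q c invariant_state_at[of s]
      by (intro nn_integral_cong_AE AE_pmfI potential_pre_step) auto
    with that show ?thesis by simp
  qed
  show main: "(\<integral>\<^sup>+st. ennreal (potential t q c s st) \<partial>state_at s) \<le> ?B"
    using assms(1)
  proof (induction s)
    case 0
    \<comment> \<open>Initially nothing is sampled, so every edge alive at \<open>t\<close> counts
      as yet to come.\<close>
    have "alive t \<subseteq> set es"
      using assms(2) by (auto elim!: aliveE)
    then show ?case
      using q by (simp add: state_at_0 init_state_def potential_def Int_absorb2)
  next
    case (Suc s)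
    have "(\<integral>\<^sup>+st. ennreal (potential t q c (Suc s) st) \<partial>state_at (Suc s))
      \<le> (\<integral>\<^sup>+st. ennreal (potential t q c (Suc s) st) \<partial>pre_state_at s)"
      using Suc.prems assms(2) q c invariant_pre_state_at[of s]
      by (auto simp: state_at_Suc intro!: nn_integral_mono_AE AE_pmfI potential_post_step)
    also have "\<dots> \<le> ?B" using Suc by (intro pre) auto
    finally show ?case .
  qed
  show "s < t \<Longrightarrow> (\<integral>\<^sup>+st. ennreal (potential t q c (Suc s) st) \<partial>pre_state_at s) \<le> ?B"
    by (rule pre[OF main])
qed

lemma potential_at_end:
  assumes "invariant t st" "t \<le> length es" "rate st = q" "0 < q"
  shows "potential t q c t st = (1 + c) ^ card (sample st)"
proof -
  have "alive t \<inter> set (drop t es) = {}"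
  proof -
    have "alive t \<subseteq> set (take t es)"
      using assms(2) by (auto elim!: aliveE simp: in_set_conv_nth intro!: exI nth_take)
    then show ?thesis using set_take_disj_set_drop_if_distinct[OF distinct_es order_refl, of t] by blast
  qed
  then show ?thesis
    using assms invariant_sample[OF assms(1)] by (simp add: potential_def Int_absorb2)
qed

text \<open>Exponential Markov inequality for both tails: the comparison multiplied by
  \<open>ln (1 + c)\<close> means at least \<open>a\<close> for positive \<open>c\<close> and at
  most \<open>a\<close> for negative \<open>c\<close>.\<close>

lemma sample_tail_bound:
  assumes M: "M = state_at t \<or> (\<exists>s. t = Suc s \<and> M = pre_state_at s)"
    and t: "t \<le> length es" and q: "0 < q" "q \<le> 1" and c: "- 1 < c"
    and A: "\<And>st. st \<in> A \<Longrightarrow> rate st = q \<and> a * ln (1 + c) \<le> real (card (sample st)) * ln (1 + c)"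
  shows "measure_pmf.prob M A \<le> exp (q * real (card (alive t)) * c - a * ln (1 + c))"
proof -
  have inv: "invariant t st" if "st \<in> set_pmf M" for st
    using M that t invariant_state_at[of t] invariant_pre_state_at by auto
  have "measure_pmf.prob M A \<le> (1 + q * c) ^ card (alive t) / exp (a * ln (1 + c))"
  proof (rule prob_Markov_nn_integral)
    show "(\<integral>\<^sup>+st. ennreal (potential t q c t st) \<partial>M) \<le> ennreal ((1 + q * c) ^ card (alive t))"
      using M t q c potential_state_at[of _ t q c] by auto
    show "0 \<le> (1 + q * c) ^ card (alive t)"
      using q c by (intro zero_le_power one_plus_mult_nonneg) auto
    fix st assume st: "st \<in> set_pmf M" "st \<in> A"
    have "exp (a * ln (1 + c)) \<le> exp (real (card (sample st)) * ln (1 + c))"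
      using A[OF st(2)] by simp
    also have "\<dots> = (1 + c) ^ card (sample st)"
      using c by (simp add: exp_of_nat_mult)
    also have "\<dots> = potential t q c t st"
      using potential_at_end[OF inv[OF st(1)] t] A[OF st(2)] q by simp
    finally show "exp (a * ln (1 + c)) \<le> potential t q c t st" .
  qed simp
  also have "\<dots> \<le> exp (real (card (alive t)) * (q * c)) / exp (a * ln (1 + c))"
    using one_plus_mult_nonneg[of q c] q c by (intro divide_right_mono one_plus_power_le_exp) auto
  also have "\<dots> = exp (q * real (card (alive t)) * c - a * ln (1 + c))"
    by (simp add: exp_diff mult_ac)
  finally show ?thesis .
qed

section \<open>The union bound\<close>

lemma maxest_pre_step:
  assumes "st' \<in> set_pmf (pre_step s st)"
  shows "maxest st' = maxest st" "rate st' = rate st"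
  using assms by (auto simp: pre_step_def)

text \<open>Inductively the sample before subsampling is \<open>alive (Suc s)\<close>, of size at
  most \<open>E_star\<close>, so the rate is never halved and every estimate is exact.\<close>

lemma state_at_exact:
  assumes thr: "real (E_star \<alpha> es) \<le> threshold" and s: "s \<le> length es"
    and st: "st \<in> set_pmf (state_at s)"
  shows "rate st = 1 \<and> maxest st \<le> real (E_star \<alpha> es) \<and> (\<forall>t\<le>s. real (card (alive t)) \<le> maxest st)"
  using s st
proof (induction s arbitrary: st)
  case 0
  then show ?case by (simp add: state_at_0 init_state_def)
next
  case (Suc s)
  then obtain x y where x: "x \<in> set_pmf (state_at s)" and y: "y \<in> set_pmf (pre_step s x)"
    and st: "st \<in> set_pmf (post_step y)"
    by (auto simp: state_at_Suc pre_state_at_def)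
  have IH: "rate x = 1" "maxest x \<le> real (E_star \<alpha> es)" "\<And>t. t \<le> s \<Longrightarrow> real (card (alive t)) \<le> maxest x"
    using Suc x by auto
  have "invariant (Suc s) y"
    using Suc.prems x y by (intro invariant_pre_step[OF invariant_state_at]) auto
  then have smp: "sample y = alive (Suc s)"
    using IH maxest_pre_step[OF y] by (intro invariant_full) auto
  have le: "card (alive (Suc s)) \<le> E_star \<alpha> es"
    using Suc.prems by (intro card_E_alpha_le_E_star) auto
  with thr smp have "real (card (sample y)) \<le> threshold" by simp
  with st have "st = update_max y" by (cases rule: post_step_cases) auto
  then show ?case
    using IH maxest_pre_step[OF y] smp le by (auto simp: update_max_def le_Suc_eq le_max_iff_disj)
qed

lemma algorithm_output_eq: "algorithm_output \<alpha> \<epsilon> n es = map_pmf maxest (state_at (length es))"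
  by (simp add: algorithm_output_def state_at_def)

lemma output_exact:
  assumes "real (E_star \<alpha> es) \<le> threshold" "x \<in> set_pmf (algorithm_output \<alpha> \<epsilon> n es)"
  shows "x = real (E_star \<alpha> es)"
proof -
  obtain st where st: "st \<in> set_pmf (state_at (length es))" "x = maxest st"
    using assms(2) by (auto simp: algorithm_output_eq)
  note * = state_at_exact[OF assms(1) order_refl st(1)]
  have "real (E_star \<alpha> es) \<le> maxest st"
  proof (cases "E_star \<alpha> es = 0")
    case True
    then show ?thesis using * by auto
  next
    case False
    then obtain t where "t \<le> length es" "card (alive t) = E_star \<alpha> es"
      using E_star_attained[of \<alpha> es] by auto
    then show ?thesis using * by metis
  qed
  with * st show ?thesis by auto
qed

text \<open>The choice \<open>c = \<epsilon>\<close> is optimal when the mean is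
  \<open>q * E_star\<close>. A smaller mean only helps, so the bound is uniform in
  \<open>t\<close>.\<close>

lemma prob_overestimate:
  assumes \<epsilon>: "0 < \<epsilon>" "\<epsilon> < 1" and t: "t \<le> length es" and q: "0 < q" "q \<le> 1"
  shows "measure_pmf.prob (state_at t)
      {st. rate st = q \<and> (1 + \<epsilon>) * (q * real (E_star \<alpha> es)) < real (card (sample st))}
    \<le> exp (- (9 / 25 * \<epsilon>\<^sup>2 * (q * real (E_star \<alpha> es))))"
proof -
  let ?N = "real (E_star \<alpha> es)"
  have "measure_pmf.prob (state_at t)
      {st. rate st = q \<and> (1 + \<epsilon>) * (q * ?N) < real (card (sample st))}
    \<le> exp (q * real (card (alive t)) * \<epsilon> - (1 + \<epsilon>) * (q * ?N) * ln (1 + \<epsilon>))"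
    using \<epsilon> by (intro sample_tail_bound t q) (auto intro!: mult_right_mono)
  also have "q * real (card (alive t)) * \<epsilon> \<le> q * ?N * \<epsilon>"
    using \<epsilon> q card_E_alpha_le_E_star[OF t] by (intro mult_left_mono mult_right_mono) auto
  also have "q * ?N * \<epsilon> - (1 + \<epsilon>) * (q * ?N) * ln (1 + \<epsilon>) = - ((q * ?N) * ((1 + \<epsilon>) * ln (1 + \<epsilon>) - \<epsilon>))"
    by (simp add: algebra_simps)
  also have "\<dots> \<le> - ((q * ?N) * (9 / 25 * \<epsilon>\<^sup>2))"
    using q by (intro le_imp_neg_le mult_left_mono upper_tail_exponent \<epsilon>) auto
  finally show ?thesis by (simp add: mult_ac)
qed

text \<open>The choice is \<open>c = - \<epsilon>\<close>. Unlike for the upper tail, a smaller mean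
  would hurt, hence the restriction to a time where \<open>E_star\<close> is attained.\<close>

lemma prob_underestimate:
  assumes \<epsilon>: "0 < \<epsilon>" "\<epsilon> < 1" and t: "t \<le> length es" and q: "0 < q" "q \<le> 1"
    and max: "card (alive t) = E_star \<alpha> es"
  shows "measure_pmf.prob (state_at t)
      {st. rate st = q \<and> real (card (sample st)) < (1 - \<epsilon>) * (q * real (E_star \<alpha> es))}
    \<le> exp (- (9 / 25 * \<epsilon>\<^sup>2 * (q * real (E_star \<alpha> es))))"
proof -
  let ?N = "real (E_star \<alpha> es)"
  have "measure_pmf.prob (state_at t)
      {st. rate st = q \<and> real (card (sample st)) < (1 - \<epsilon>) * (q * ?N)}
    \<le> exp (q * real (card (alive t)) * (- \<epsilon>) - (1 - \<epsilon>) * (q * ?N) * ln (1 + - \<epsilon>))"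
    using \<epsilon> by (intro sample_tail_bound t q) (auto intro!: mult_right_mono_neg)
  also have "q * real (card (alive t)) * (- \<epsilon>) - (1 - \<epsilon>) * (q * ?N) * ln (1 + - \<epsilon>)
      = - ((q * ?N) * ((1 - \<epsilon>) * ln (1 - \<epsilon>) + \<epsilon>))"
    using max by (simp add: algebra_simps)
  also have "\<dots> \<le> - ((q * ?N) * (9 / 25 * \<epsilon>\<^sup>2))"
    using q by (intro le_imp_neg_le mult_left_mono lower_tail_exponent \<epsilon>) auto
  finally show ?thesis by (simp add: mult_ac)
qed

text \<open>Overflow exceeds the bound on the mean by a factor \<open>5 / 3\<close>, hence
  \<open>c = 2 / 3\<close>. The constant is
  \<open>107 / 1000 = 507 / 1000 - 2 / 3 * (3 / 5)\<close>.\<close>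

lemma prob_overflow:
  assumes s: "s < length es" and q: "0 < q" "q \<le> 1"
    and small: "q * real (E_star \<alpha> es) \<le> 3 / 5 * threshold"
  shows "measure_pmf.prob (pre_state_at s) {st. rate st = q \<and> threshold < real (card (sample st))}
    \<le> exp (- (107 / 1000 * threshold))"
proof -
  have thr: "0 \<le> threshold"
  proof -
    have "0 \<le> q * real (E_star \<alpha> es)" using q by simp
    then show ?thesis using small by simp
  qed
  have "measure_pmf.prob (pre_state_at s) {st. rate st = q \<and> threshold < real (card (sample st))}
    \<le> exp (q * real (card (alive (Suc s))) * (2 / 3) - threshold * ln (1 + 2 / 3))"
    using s by (intro sample_tail_bound q) (auto intro!: mult_right_mono)
  also have "\<dots> \<le> exp (- (107 / 1000 * threshold))"
  proof -
    have "q * real (card (alive (Suc s))) \<le> q * real (E_star \<alpha> es)"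
      using q card_E_alpha_le_E_star[of "Suc s" es \<alpha>] s by (intro mult_left_mono) auto
    moreover have "threshold * (507 / 1000) \<le> threshold * ln (1 + 2 / 3)"
      using ln_five_thirds_ge thr by (intro mult_left_mono) auto
    ultimately show ?thesis using small by simp
  qed
  finally show ?thesis .
qed

text \<open>The lower bound is demanded only from time \<open>T\<close> on; once reached it
  persists, because \<open>maxest\<close> never decreases.\<close>

definition good :: "nat \<Rightarrow> nat \<Rightarrow> nat \<Rightarrow> 'a state \<Rightarrow> bool" where
  "good K T s st \<longleftrightarrow> 1 / 2 ^ K \<le> rate st \<and> maxest st \<le> (1 + \<epsilon>) * real (E_star \<alpha> es)
    \<and> (T \<le> s \<longrightarrow> (1 - \<epsilon>) * real (E_star \<alpha> es) \<le> maxest st)"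

text \<open>Levels are indexed by their distance from \<open>K\<close>, in which the failure
  probability decays geometrically.\<close>

definition overestimate :: "nat \<Rightarrow> 'a state set" where
  "overestimate K = (\<Union>j\<in>{..K}. {st. rate st = 1 / 2 ^ (K - j)
      \<and> (1 + \<epsilon>) * (1 / 2 ^ (K - j) * real (E_star \<alpha> es)) < real (card (sample st))})"

definition underestimate :: "nat \<Rightarrow> 'a state set" where
  "underestimate K = (\<Union>j\<in>{..K}. {st. rate st = 1 / 2 ^ (K - j)
      \<and> real (card (sample st)) < (1 - \<epsilon>) * (1 / 2 ^ (K - j) * real (E_star \<alpha> es))})"

text \<open>\<open>maxest\<close> can only move to the current estimate, so a failure stems from
  that estimate being too high, or too low at time \<open>T\<close>. The rate falls below
  \<open>1 / 2 ^ K\<close> only by halving at level \<open>K\<close>, which is excluded.\<close>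

lemma good_post_step:
  assumes inv: "invariant (Suc s) x" and good: "good K T s x"
    and no_overflow: "\<not> (rate x = 1 / 2 ^ K \<and> threshold < real (card (sample x)))"
    and y: "y \<in> set_pmf (post_step x)" and bad: "\<not> good K T (Suc s) y"
  shows "y \<in> overestimate K \<union> (if Suc s = T then underestimate K else {})"
proof -
  let ?N = "real (E_star \<alpha> es)"
  have rate_y: "1 / 2 ^ K \<le> rate y"
    using y
  proof (cases rule: post_step_cases)
    case 1
    then show ?thesis using good by (simp add: good_def update_max_def)
  next
    case (2 keep)
    obtain j where j: "rate x = 1 / 2 ^ j" using invariant_rate[OF inv] by auto
    have "(2::real) ^ j \<le> 2 ^ K" using good j by (simp add: good_def field_simps)
    then have "j \<le> K" by simp
    moreover have "j \<noteq> K" using no_overflow 2 j by auto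
    ultimately have "Suc j \<le> K" by simp
    then have "(2::real) ^ Suc j \<le> 2 ^ K" by (intro power_increasing) auto
    then show ?thesis using 2 j by (simp add: update_max_def field_simps)
  qed
  obtain k where k: "rate y = 1 / 2 ^ k"
    using invariant_rate[OF invariant_post_step[OF inv y]] by auto
  have "(2::real) ^ k \<le> 2 ^ K" using rate_y k by (simp add: field_simps)
  then have "k \<le> K" by simp
  have max: "maxest y = max (maxest x) (real (card (sample y)) / rate y)"
    by (rule maxest_post_step[OF y])
  have cases: "(1 + \<epsilon>) * ?N < real (card (sample y)) / rate y
      \<or> Suc s = T \<and> real (card (sample y)) / rate y < (1 - \<epsilon>) * ?N"
    using bad good rate_y unfolding good_def max by (auto simp: le_Suc_eq)
  have "y \<in> overestimate K" if "(1 + \<epsilon>) * ?N < real (card (sample y)) / rate y"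
    using that k \<open>k \<le> K\<close> unfolding overestimate_def
    by (auto intro!: bexI[of _ "K - k"] simp: field_simps)
  moreover have "y \<in> underestimate K" if "real (card (sample y)) / rate y < (1 - \<epsilon>) * ?N"
    using that k \<open>k \<le> K\<close> unfolding underestimate_def
    by (auto intro!: bexI[of _ "K - k"] simp: field_simps)
  ultimately show ?thesis using cases by auto
qed

text \<open>Each step is charged \<open>r\<close> for overflow and \<open>g\<close> for an
  overestimate; the underestimate is charged once, at the step that reaches
  \<open>T\<close>.\<close>

lemma prob_not_good:
  assumes T: "1 \<le> T" and \<epsilon>: "0 < \<epsilon>"
    and over: "\<And>t. t \<le> length es \<Longrightarrow> measure_pmf.prob (state_at t) (overestimate K) \<le> g"
    and under: "measure_pmf.prob (state_at T) (underestimate K) \<le> g"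
    and overflow: "\<And>s. s < length es \<Longrightarrow> measure_pmf.prob (pre_state_at s)
        {st. rate st = 1 / 2 ^ K \<and> threshold < real (card (sample st))} \<le> r"
  shows "s \<le> length es \<Longrightarrow> measure_pmf.prob (state_at s) {st. \<not> good K T s st}
    \<le> real s * (r + g) + (if T \<le> s then g else 0)"
proof (induction s)
  case 0
  then show ?case
    using T \<epsilon> by (simp add: state_at_0 good_def init_state_def indicator_def)
next
  case (Suc s)
  let ?O = "{st. rate st = 1 / 2 ^ K \<and> threshold < real (card (sample st))}"
  let ?U = "if Suc s = T then underestimate K else {}"
  have s: "s < length es" using Suc.prems by simp
  have "measure_pmf.prob (state_at (Suc s)) {st. \<not> good K T (Suc s) st}
    \<le> measure_pmf.prob (pre_state_at s) ({st. \<not> good K T s st} \<union> ?O)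
      + measure_pmf.prob (state_at (Suc s)) (overestimate K \<union> ?U)"
    unfolding state_at_Suc[OF s]
  proof (rule prob_bind_le)
    fix x y
    assume "x \<in> set_pmf (pre_state_at s)" "x \<notin> {st. \<not> good K T s st} \<union> ?O"
      "y \<in> set_pmf (post_step x)" "y \<in> {st. \<not> good K T (Suc s) st}"
    then show "y \<in> overestimate K \<union> ?U"
      using invariant_pre_state_at[OF s] by (intro good_post_step[of s x]) auto
  qed
  also have "measure_pmf.prob (pre_state_at s) ({st. \<not> good K T s st} \<union> ?O)
    \<le> measure_pmf.prob (pre_state_at s) {st. \<not> good K T s st} + r"
    using overflow[OF s] by (intro order.trans[OF measure_Un_le]) auto
  \<comment> \<open>Inserting an edge changes neither the rate nor \<open>maxest\<close>, so it
    cannot destroy \<open>good\<close>.\<close>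
  also have "measure_pmf.prob (pre_state_at s) {st. \<not> good K T s st}
    \<le> measure_pmf.prob (state_at s) {st. \<not> good K T s st} + measure_pmf.prob (pre_state_at s) {}"
    unfolding pre_state_at_def
    by (rule prob_bind_le) (auto simp: good_def maxest_pre_step)
  also have "measure_pmf.prob (state_at (Suc s)) (overestimate K \<union> ?U)
    \<le> g + (if Suc s = T then g else 0)"
    using over[OF Suc.prems] under by (intro order.trans[OF measure_Un_le] add_mono) auto
  finally show ?case
    using Suc by (auto simp: algebra_simps split: if_splits)
qed

lemma output_approximation:
  assumes \<epsilon>: "0 < \<epsilon>" "\<epsilon> < 1" and n: "2 \<le> n"
    and large: "3 / 5 * threshold < real (E_star \<alpha> es)"
    and m: "real (length es) + 1 \<le> real n ^ 2 / 2"
  shows "1 - 1 / real n \<le> measure_pmf.prob (algorithm_output \<alpha> \<epsilon> n es)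
    {(1 - \<epsilon>) * real (E_star \<alpha> es) .. (1 + \<epsilon>) * real (E_star \<alpha> es)}"
proof -
  let ?N = "real (E_star \<alpha> es)"
  define L where "L = ln (real n)"
  define r where "r = exp (- (16 / 5 * L))"
  have "ln 2 \<le> L" unfolding L_def using n by simp
  then have L: "2 / 3 \<le> L" using ln2_ge_two_thirds by simp
  have \<epsilon>2: "0 < \<epsilon>\<^sup>2" "\<epsilon>\<^sup>2 \<le> 1" using \<epsilon> by (auto simp: power_le_one)
  have thr_eq: "\<epsilon>\<^sup>2 * threshold = 30 * L" using \<epsilon> by (simp add: threshold_def L_def)
  have "30 * L / 1 \<le> 30 * L / \<epsilon>\<^sup>2"
    using \<epsilon>2 L by (intro divide_left_mono) auto
  then have thr: "30 * L \<le> threshold" by (simp add: threshold_def L_def)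
  then have thr_pos: "0 < threshold" using L by simp
  obtain T where T: "1 \<le> T" "T \<le> length es" "card (alive T) = E_star \<alpha> es"
    using large thr_pos E_star_attained[of \<alpha> es] by auto
  \<comment> \<open>More than 12 edges are alive at time \<open>T\<close>, which forces n above 4
    and improves the first bound on \<open>L\<close>.\<close>
  have L_ge: "4 / 3 \<le> L"
  proof -
    have "?N \<le> real (length es)" using card_E_alpha_le[of \<alpha> es T] T by simp
    then have "4 ^ 2 < real n ^ 2" using large m thr L by simp
    then have "4 < real n" by (rule power_less_imp_less_base) simp
    then have "ln (2 * 2) \<le> L" unfolding L_def by (subst ln_le_cancel_iff) auto
    also have "ln (2 * 2) = ln 2 + ln (2::real)" by (rule ln_mult_pos) auto
    finally show ?thesis using ln2_ge_two_thirds by simp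
  qed
  note numeric = union_bound_numeric[OF L_ge L_def _ m, folded r_def]
  have r: "0 \<le> r" "r < 1" using numeric n by (auto simp: r_def)
  \<comment> \<open>The factor \<open>3 / 5\<close> balances two failures at level \<open>K\<close> whose probabilities, as powers of \<open>1 / n\<close>,
    need exponents above 3 for a union over \<open>n\<^sup>2 / 2\<close> times: overflow (exponent at least 3.21) and
    relative error \<open>\<epsilon>\<close> (exponent at least 3.24).\<close>
  define small where "small k \<longleftrightarrow> 1 / 2 ^ k * ?N \<le> 3 / 5 * threshold" for k :: nat
  define K where "K = (LEAST k. small k)"
  have "\<exists>k. small k"
  proof -
    obtain k where "?N / (3 / 5 * threshold) < 2 ^ k"
      using real_arch_pow[of 2] by auto
    then have "small k" using thr_pos by (simp add: small_def field_simps)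
    then show ?thesis ..
  qed
  then have K: "small K" unfolding K_def by (rule LeastI_ex)
  have "\<not> small 0" using large by (simp add: small_def)
  with K have "K \<noteq> 0" by metis
  then have "\<not> small (K - 1)" unfolding K_def by (intro not_less_Least) simp
  \<comment> \<open>Level \<open>K - 1\<close> is still above \<open>3 / 5 * threshold\<close>, so
    level \<open>K\<close> is above half of it.\<close>
  then have K_ge: "3 / 10 * threshold \<le> 1 / 2 ^ K * ?N"
    using \<open>K \<noteq> 0\<close> by (cases K) (auto simp: small_def field_simps)
  have level: "exp (- (9 / 25 * \<epsilon>\<^sup>2 * (1 / 2 ^ (K - j) * ?N))) \<le> r ^ Suc j" if "j \<le> K" for j
  proof -
    have "16 / 5 * L \<le> 9 / 25 * (3 / 10 * (\<epsilon>\<^sup>2 * threshold))"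
      unfolding thr_eq using L by simp
    also have "\<dots> = 9 / 25 * \<epsilon>\<^sup>2 * (3 / 10 * threshold)" by simp
    also have "\<dots> \<le> 9 / 25 * \<epsilon>\<^sup>2 * (1 / 2 ^ K * ?N)"
      using K_ge by (intro mult_left_mono) auto
    finally have "16 / 5 * L * 2 ^ j \<le> 9 / 25 * \<epsilon>\<^sup>2 * (1 / 2 ^ K * ?N) * 2 ^ j"
      by (rule mult_right_mono) simp
    also have "\<dots> = 9 / 25 * \<epsilon>\<^sup>2 * (1 / 2 ^ (K - j) * ?N)"
      using that by (simp add: power_diff)
    finally have "exp (- (9 / 25 * \<epsilon>\<^sup>2 * (1 / 2 ^ (K - j) * ?N))) \<le> exp (- (16 / 5 * L * 2 ^ j))"
      by simp
    also have "\<dots> \<le> r ^ Suc j"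
      unfolding r_def using L by (intro exp_level_bound) simp
    finally show ?thesis .
  qed
  have union: "measure_pmf.prob M (\<Union>j\<in>{..K}. A j) \<le> r / (1 - r)"
    if "\<And>j. j \<le> K \<Longrightarrow> measure_pmf.prob M (A j) \<le> exp (- (9 / 25 * \<epsilon>\<^sup>2 * (1 / 2 ^ (K - j) * ?N)))"
    for M and A :: "nat \<Rightarrow> 'a state set"
  proof -
    have "measure_pmf.prob M (\<Union>j\<in>{..K}. A j) \<le> (\<Sum>j\<le>K. measure_pmf.prob M (A j))"
      by (rule measure_UNION_le) auto
    also have "\<dots> \<le> (\<Sum>j\<le>K. r ^ Suc j)"
      using that level by (intro sum_mono) (meson atMost_iff order.trans)
    also have "\<dots> \<le> r / (1 - r)" by (rule sum_powers_le[OF r])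
    finally show ?thesis .
  qed
  have "measure_pmf.prob (state_at (length es)) {st. \<not> good K T (length es) st}
    \<le> real (length es) * (r + r / (1 - r)) + (if T \<le> length es then r / (1 - r) else 0)"
  proof (rule prob_not_good[OF T(1) \<epsilon>(1)])
    show "measure_pmf.prob (state_at t) (overestimate K) \<le> r / (1 - r)" if "t \<le> length es" for t
      unfolding overestimate_def using \<epsilon> that by (intro union prob_overestimate) auto
    show "measure_pmf.prob (state_at T) (underestimate K) \<le> r / (1 - r)"
      unfolding underestimate_def using \<epsilon> T by (intro union prob_underestimate) auto
    show "measure_pmf.prob (pre_state_at s)
        {st. rate st = 1 / 2 ^ K \<and> threshold < real (card (sample st))} \<le> r" if "s < length es" for s
    proof -
      have "measure_pmf.prob (pre_state_at s)
        {st. rate st = 1 / 2 ^ K \<and> threshold < real (card (sample st))} \<le> exp (- (107 / 1000 * threshold))"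
        using K that by (intro prob_overflow) (auto simp: small_def)
      also have "\<dots> \<le> r" unfolding r_def using thr L by simp
      finally show ?thesis .
    qed
  qed simp
  also have "\<dots> \<le> 1 / real n" using numeric(2) T n by simp
  finally have bad: "measure_pmf.prob (state_at (length es)) {st. \<not> good K T (length es) st} \<le> 1 / real n" .
  have "1 - 1 / real n \<le> measure_pmf.prob (state_at (length es)) {st. good K T (length es) st}"
    using bad measure_pmf.prob_compl[of "{st. \<not> good K T (length es) st}" "state_at (length es)"]
    by (simp add: Compl_eq_Diff_UNIV[symmetric] Collect_neg_eq[symmetric])
  also have "\<dots> \<le> measure_pmf.prob (state_at (length es)) (maxest -` {(1 - \<epsilon>) * ?N .. (1 + \<epsilon>) * ?N})"
    using T by (intro measure_pmf.finite_measure_mono) (auto simp: good_def)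
  finally show ?thesis by (simp add: algorithm_output_eq)
qed

end

section \<open>Stream length in a simple graph, and the two cases\<close>

lemma length_edge_stream:
  assumes "simple_graph V E" "edge_stream E es"
  shows "length es \<le> card V * (card V - 1) div 2"
proof -
  have fin: "finite V" using assms by (simp add: simple_graph_def)
  have "length es = card E" using assms distinct_card by (force simp: edge_stream_def)
  also have "\<dots> \<le> card {e. e \<subseteq> V \<and> card e = 2}"
    using assms fin by (intro card_mono) (auto simp: simple_graph_def)
  also have "\<dots> = card V choose 2" by (rule n_subsets[OF fin])
  finally show ?thesis by (simp add: choose_two)
qed

theorem theorem3:
  "\<exists>c::nat. c \<ge> 1 \<and>
     (\<forall>(\<alpha>::nat) (\<epsilon>::real) (n::nat) (V::'a set) (E::'a set set) (es::'a set list).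
        \<alpha> \<ge> 1 \<longrightarrow> 0 < \<epsilon> \<longrightarrow> \<epsilon> < 1 \<longrightarrow>
        simple_graph V E \<longrightarrow> card V = n \<longrightarrow> edge_stream E es \<longrightarrow>
        measure_pmf.prob (algorithm_output \<alpha> \<epsilon> n es)
          {(1 - \<epsilon>) * real (E_star \<alpha> es) .. (1 + \<epsilon>) * real (E_star \<alpha> es)}
        \<ge> 1 - 1 / real n ^ c)"
proof (intro exI[of _ 1] conjI allI impI order_refl)
  fix \<alpha> :: nat and \<epsilon> :: real and n :: nat and V :: "'a set" and E :: "'a set set"
    and es :: "'a set list"
  assume \<epsilon>: "0 < \<epsilon>" "\<epsilon> < 1" and G: "simple_graph V E" "card V = n" "edge_stream E es"
  interpret edge_sampling \<alpha> \<epsilon> n es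
    by unfold_locales (use G in \<open>simp add: edge_stream_def\<close>)
  let ?N = "real (E_star \<alpha> es)"
  \<comment> \<open>For \<open>n = 0\<close> both \<open>ln 0\<close> and \<open>1 / 0\<close> are
    0: the threshold is 0 and probability 1 is claimed, which the exact case provides.\<close>
  have thr: "0 \<le> threshold"
    unfolding threshold_def by (cases "n = 0") auto
  have len: "length es \<le> n * (n - 1) div 2"
    using length_edge_stream[OF G(1,3)] G(2) by simp
  show "1 - 1 / real n ^ 1 \<le> measure_pmf.prob (algorithm_output \<alpha> \<epsilon> n es)
      {(1 - \<epsilon>) * ?N .. (1 + \<epsilon>) * ?N}"
  \<comment> \<open>Splitting at \<open>3 / 5 * threshold\<close> rather than at
    \<open>threshold\<close> makes the level \<open>K\<close> positive in the second case; the first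
    is still exact.\<close>
  proof (cases "?N \<le> 3 / 5 * threshold")
    case True
    with thr have le: "?N \<le> threshold" by simp
    have "x \<in> {(1 - \<epsilon>) * ?N .. (1 + \<epsilon>) * ?N}" if "x \<in> set_pmf (algorithm_output \<alpha> \<epsilon> n es)" for x
      using output_exact[OF le that] \<epsilon> by (simp add: algebra_simps)
    then have "measure_pmf.prob (algorithm_output \<alpha> \<epsilon> n es) {(1 - \<epsilon>) * ?N .. (1 + \<epsilon>) * ?N} = 1"
      by (subst measure_pmf.prob_eq_1) (auto intro: AE_pmfI)
    then show ?thesis by simp
  next
    case False
    then have "0 < E_star \<alpha> es" using thr by (cases "E_star \<alpha> es") auto
    then obtain t where "1 \<le> t" "t \<le> length es" by (rule E_star_attained)
    with len have n: "2 \<le> n" by (cases n; cases "n - 1") auto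
    have "2 * length es \<le> n * (n - 1)" using len by linarith
    then have "2 * real (length es) \<le> real (n * (n - 1))" by (metis of_nat_le_iff of_nat_mult of_nat_numeral)
    also have "\<dots> = real n ^ 2 - real n" using n by (simp add: power2_eq_square algebra_simps of_nat_diff)
    finally have "real (length es) + 1 \<le> real n ^ 2 / 2" using n by simp
    with False \<epsilon> n show ?thesis using output_approximation by simp
  qed
qed

end
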